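(* Let $X$ be a compact Riemann surface of genus $g>1$, $h=\{h_i\}$ a smooth projective connection on $X$, and $f:X\to\tilde X$ a deformation map with Beltrami differential $\mu=\{\mu_i\}$. The Euler–Lagrange equation $$\bar\partial h_i=\mathcal D_h\mu_i$$ for the vertical variational problem (in all coordinate charts) is the condition that the push-forward $f_*(h)$ of the projective connection $h$ onto $\tilde X$ by the map $f$ is holomorphic; i.e. the equation holds if and only if $f_*(h)$ is a holomorphic projective connection on $\tilde X$.
   Context: Setting: $\{U_i\}$ is a good open cover of $X$ with holomorphic coordinates $z_i$, transition functions $z_i=z_{ij}\circ z_j$. A deformation map is an orientation-preserving diffeomorphism $f:X\to\tilde X$ onto a Riemann surface $\tilde X$; $w_i$ are holomorphic coordinates on $V_i=f(U_i)$ with $w_i=w_{ij}\circ w_j$; $f_i=w_i\circ f\circ z_i^{-1}$; $\partial=\partial/\partial z_i$, $\bar\partial=\partial/\partial\bar z_i$; $\mu_i=\bar\partial f_i/\partial f_i$. Schwarzian: $\{u,z\}=\frac{\partial^3u}{\partial u}-\frac32\bigl(\frac{\partial^2u}{\partial u}\bigr)^2$ with $\partial=\partial/\partial z$ (used also for non-holomorphic $u$); $\{z_i,z_j\}$ means $\{z_{ij},z_j\}$. A smooth projective connection on $X$ is a collection $h=\{h_i\}$ of smooth functions with $h_j-h_i\circ z_{ij}(z'_{ij})^2=\{z_i,z_j\}$ on $U_i\cap U_j$ (and similarly on $\tilde X$ with $w_i$); it is holomorphic if all $h_i$ are. $\mathcal D_h=\partial^3+2h\,\partial+\partial h$, so $\mathcal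 D_h\mu=\partial^3\mu+2h\,\partial\mu+(\partial h)\mu$. Push-forward: put $\tilde h_i=h_i-\{f_i,z_i\}$, which satisfies $\tilde h_j-\tilde h_i\circ z_{ij}(z'_{ij})^2=\{w_i,w_j\}\circ f_j\,(\partial f_j)^2$; then $f_*(h)=\{H_i\}$ is the smooth projective connection on $\tilde X$ determined by $H_i\circ f_i\cdot(\partial f_i)^2=\tilde h_i$. The equation $\bar\partial h=\mathcal D_h\mu$ is the Euler–Lagrange equation of the Polyakov action $S[f]$ (with local density $\frac{\partial^2f_i}{\partial f_i}\partial\mu_i\,dz_i\wedge d\bar z_i+2\mu_ih_i\,dz_i\wedge d\bar z_i$) under variations of $f$ that do not change the complex structure of $\tilde X$. *)

theory Defs
  imports "HOL-Complex_Analysis.Complex_Analysis" "HOL-Homology.Homology"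
begin

section \<open>Smooth functions and Wirtinger calculus in the plane\<close>

(* Meant for open S: then every derivative below depends only on f restricted to S.
   Differentiability is real (Frechet) differentiability. *)
primrec Ck_on ::
  "nat \<Rightarrow> ('a::real_normed_vector \<Rightarrow> 'b::real_normed_vector) \<Rightarrow> 'a set \<Rightarrow> bool" where
  "Ck_on 0 f S \<longleftrightarrow> continuous_on S f"
| "Ck_on (Suc k) f S \<longleftrightarrow>
     (\<forall>x\<in>S. f differentiable at x) \<and>
     (\<forall>v. Ck_on k (\<lambda>x. frechet_derivative f (at x) v) S)"

definition smooth_on :: "('a::real_normed_vector \<Rightarrow> 'b::real_normed_vector) \<Rightarrow> 'a set \<Rightarrow> bool" where
  "smooth_on f S \<longleftrightarrow> (\<forall>k. Ck_on k f S)"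

definition partial_x :: "(complex \<Rightarrow> complex) \<Rightarrow> complex \<Rightarrow> complex" where
  "partial_x f \<zeta> = frechet_derivative f (at \<zeta>) 1"

definition partial_y :: "(complex \<Rightarrow> complex) \<Rightarrow> complex \<Rightarrow> complex" where
  "partial_y f \<zeta> = frechet_derivative f (at \<zeta>) \<i>"

definition del :: "(complex \<Rightarrow> complex) \<Rightarrow> complex \<Rightarrow> complex" where
  "del f \<zeta> = (partial_x f \<zeta> - \<i> * partial_y f \<zeta>) / 2"

definition delbar :: "(complex \<Rightarrow> complex) \<Rightarrow> complex \<Rightarrow> complex" where
  "delbar f \<zeta> = (partial_x f \<zeta> + \<i> * partial_y f \<zeta>) / 2"

definition jacobian_det :: "(complex \<Rightarrow> complex) \<Rightarrow> complex \<Rightarrow> real" where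
  "jacobian_det f \<zeta> =
     Re (partial_x f \<zeta>) * Im (partial_y f \<zeta>) - Re (partial_y f \<zeta>) * Im (partial_x f \<zeta>)"

definition schwarzian :: "(complex \<Rightarrow> complex) \<Rightarrow> complex \<Rightarrow> complex" where
  "schwarzian u \<zeta> =
     del (del (del u)) \<zeta> / del u \<zeta> - 3 / 2 * (del (del u) \<zeta> / del u \<zeta>)\<^sup>2"

section \<open>Riemann surfaces\<close>

(* A family of charts z i : U i \<rightarrow> C, i \<in> I.  The values of z i outside U i are irrelevant.
   local_rep U z w i j \<phi> is the map w j o \<phi> o (z i)^-1, defined on a subset of z i ` U i. *)
definition local_rep ::
  "('i \<Rightarrow> 'a set) \<Rightarrow> ('i \<Rightarrow> 'a \<Rightarrow> complex) \<Rightarrow> ('j \<Rightarrow> 'b \<Rightarrow> complex) \<Rightarrow> 'i \<Rightarrow> 'j \<Rightarrow> ('a \<Rightarrow> 'b)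
     \<Rightarrow> complex \<Rightarrow> complex" where
  "local_rep U z w i j \<phi> = w j \<circ> \<phi> \<circ> inv_into (U i) (z i)"

(* The map z_ij with z i = z_ij o z j on U i \<inter> U j. *)
definition transition ::
  "('i \<Rightarrow> 'a set) \<Rightarrow> ('i \<Rightarrow> 'a \<Rightarrow> complex) \<Rightarrow> 'i \<Rightarrow> 'i \<Rightarrow> complex \<Rightarrow> complex" where
  "transition U z i j = z i \<circ> inv_into (U j) (z j)"

definition holomorphic_atlas ::
  "'a topology \<Rightarrow> 'i set \<Rightarrow> ('i \<Rightarrow> 'a set) \<Rightarrow> ('i \<Rightarrow> 'a \<Rightarrow> complex) \<Rightarrow> bool" where
  "holomorphic_atlas X I U z \<longleftrightarrow>
     (\<Union>i\<in>I. U i) = topspace X \<and>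
     (\<forall>i\<in>I. openin X (U i) \<and> open (z i ` U i) \<and>
        homeomorphic_map (subtopology X (U i)) (top_of_set (z i ` U i)) (z i)) \<and>
     (\<forall>i\<in>I. \<forall>j\<in>I. transition U z i j holomorphic_on z j ` (U i \<inter> U j))"

definition riemann_surface ::
  "'a topology \<Rightarrow> 'i set \<Rightarrow> ('i \<Rightarrow> 'a set) \<Rightarrow> ('i \<Rightarrow> 'a \<Rightarrow> complex) \<Rightarrow> bool" where
  "riemann_surface X I U z \<longleftrightarrow>
     Hausdorff_space X \<and> connected_space X \<and> topspace X \<noteq> {} \<and> holomorphic_atlas X I U z"

definition good_cover :: "'a topology \<Rightarrow> 'i set \<Rightarrow> ('i \<Rightarrow> 'a set) \<Rightarrow> bool" where
  "good_cover X I U \<longleftrightarrow>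
     (\<Union>i\<in>I. U i) = topspace X \<and> (\<forall>i\<in>I. openin X (U i)) \<and>
     (\<forall>J. finite J \<and> J \<noteq> {} \<and> J \<subseteq> I \<and> (\<Inter>i\<in>J. U i) \<noteq> {} \<longrightarrow>
        contractible_space (subtopology X (\<Inter>i\<in>J. U i)))"

(* For a compact Riemann surface: the first integral homology is free of rank 2g. *)
definition has_genus :: "'a topology \<Rightarrow> nat \<Rightarrow> bool" where
  "has_genus X g \<longleftrightarrow> homology_group 1 X \<cong> free_Abelian_group {..<2 * g}"

section \<open>Deformation maps\<close>

definition smooth_map ::
  "'i set \<Rightarrow> ('i \<Rightarrow> 'a set) \<Rightarrow> ('i \<Rightarrow> 'a \<Rightarrow> complex) \<Rightarrow>
   'j set \<Rightarrow> ('j \<Rightarrow> 'b set) \<Rightarrow> ('j \<Rightarrow> 'b \<Rightarrow> complex) \<Rightarrow> ('a \<Rightarrow> 'b) \<Rightarrow> bool" where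
  "smooth_map I U z J V w \<phi> \<longleftrightarrow>
     (\<forall>i\<in>I. \<forall>j\<in>J. smooth_on (local_rep U z w i j \<phi>) (z i ` (U i \<inter> \<phi> -` V j)))"

definition diffeomorphism ::
  "'a topology \<Rightarrow> 'i set \<Rightarrow> ('i \<Rightarrow> 'a set) \<Rightarrow> ('i \<Rightarrow> 'a \<Rightarrow> complex) \<Rightarrow>
   'b topology \<Rightarrow> 'j set \<Rightarrow> ('j \<Rightarrow> 'b set) \<Rightarrow> ('j \<Rightarrow> 'b \<Rightarrow> complex) \<Rightarrow> ('a \<Rightarrow> 'b) \<Rightarrow> bool" where
  "diffeomorphism X I U z Y J V w \<phi> \<longleftrightarrow>
     homeomorphic_map X Y \<phi> \<and>
     smooth_map I U z J V w \<phi> \<and>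
     smooth_map J V w I U z (inv_into (topspace X) \<phi>)"

definition orientation_preserving ::
  "'i set \<Rightarrow> ('i \<Rightarrow> 'a set) \<Rightarrow> ('i \<Rightarrow> 'a \<Rightarrow> complex) \<Rightarrow>
   'j set \<Rightarrow> ('j \<Rightarrow> 'b set) \<Rightarrow> ('j \<Rightarrow> 'b \<Rightarrow> complex) \<Rightarrow> ('a \<Rightarrow> 'b) \<Rightarrow> bool" where
  "orientation_preserving I U z J V w \<phi> \<longleftrightarrow>
     (\<forall>i\<in>I. \<forall>j\<in>J. \<forall>\<zeta> \<in> z i ` (U i \<inter> \<phi> -` V j). jacobian_det (local_rep U z w i j \<phi>) \<zeta> > 0)"

definition deformation_map ::
  "'a topology \<Rightarrow> 'i set \<Rightarrow> ('i \<Rightarrow> 'a set) \<Rightarrow> ('i \<Rightarrow> 'a \<Rightarrow> complex) \<Rightarrow>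
   'b topology \<Rightarrow> 'j set \<Rightarrow> ('j \<Rightarrow> 'b set) \<Rightarrow> ('j \<Rightarrow> 'b \<Rightarrow> complex) \<Rightarrow> ('a \<Rightarrow> 'b) \<Rightarrow> bool" where
  "deformation_map X I U z Y J V w \<phi> \<longleftrightarrow>
     riemann_surface Y J V w \<and>
     diffeomorphism X I U z Y J V w \<phi> \<and>
     orientation_preserving I U z J V w \<phi>"

definition beltrami ::
  "('i \<Rightarrow> 'a set) \<Rightarrow> ('i \<Rightarrow> 'a \<Rightarrow> complex) \<Rightarrow> ('i \<Rightarrow> 'b \<Rightarrow> complex) \<Rightarrow> ('a \<Rightarrow> 'b)
     \<Rightarrow> 'i \<Rightarrow> complex \<Rightarrow> complex" where
  "beltrami U z w f i \<zeta> =
     delbar (local_rep U z w i i f) \<zeta> / del (local_rep U z w i i f) \<zeta>"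

section \<open>Projective connections\<close>

(* h i is written in the coordinate z i, i.e. it is a function on z i ` U i. *)
definition smooth_projective_connection ::
  "'i set \<Rightarrow> ('i \<Rightarrow> 'a set) \<Rightarrow> ('i \<Rightarrow> 'a \<Rightarrow> complex) \<Rightarrow> ('i \<Rightarrow> complex \<Rightarrow> complex) \<Rightarrow> bool" where
  "smooth_projective_connection I U z h \<longleftrightarrow>
     (\<forall>i\<in>I. smooth_on (h i) (z i ` U i)) \<and>
     (\<forall>i\<in>I. \<forall>j\<in>I. \<forall>\<zeta> \<in> z j ` (U i \<inter> U j).
        h j \<zeta> - h i (transition U z i j \<zeta>) * (deriv (transition U z i j) \<zeta>)\<^sup>2
          = schwarzian (transition U z i j) \<zeta>)"

definition holomorphic_projective_connection ::
  "'i set \<Rightarrow> ('i \<Rightarrow> 'a set) \<Rightarrow> ('i \<Rightarrow> 'a \<Rightarrow> complex) \<Rightarrow> ('i \<Rightarrow> complex \<Rightarrow> complex) \<Rightarrow> bool" where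
  "holomorphic_projective_connection I U z h \<longleftrightarrow>
     smooth_projective_connection I U z h \<and> (\<forall>i\<in>I. h i holomorphic_on z i ` U i)"

definition D_op :: "(complex \<Rightarrow> complex) \<Rightarrow> (complex \<Rightarrow> complex) \<Rightarrow> complex \<Rightarrow> complex" where
  "D_op h \<mu> \<zeta> = del (del (del \<mu>)) \<zeta> + 2 * h \<zeta> * del \<mu> \<zeta> + del h \<zeta> * \<mu> \<zeta>"

(* With f_i the local representative of f, this is the H_i determined on f_i(z i ` U i) by
   H_i o f_i * (del f_i)^2 = h_i - {f_i, z_i}. *)
definition push_forward ::
  "('i \<Rightarrow> 'a set) \<Rightarrow> ('i \<Rightarrow> 'a \<Rightarrow> complex) \<Rightarrow> ('i \<Rightarrow> 'b \<Rightarrow> complex) \<Rightarrow> ('a \<Rightarrow> 'b)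
     \<Rightarrow> ('i \<Rightarrow> complex \<Rightarrow> complex) \<Rightarrow> 'i \<Rightarrow> complex \<Rightarrow> complex" where
  "push_forward U z w f h i \<eta> =
     (let F = local_rep U z w i i f; \<zeta> = inv_into (z i ` U i) F \<eta>
      in (h i \<zeta> - schwarzian F \<zeta>) / (del F \<zeta>)\<^sup>2)"

(* The Euler-Lagrange equation of the Polyakov action under vertical variations. *)
definition euler_lagrange ::
  "'i set \<Rightarrow> ('i \<Rightarrow> 'a set) \<Rightarrow> ('i \<Rightarrow> 'a \<Rightarrow> complex) \<Rightarrow> ('i \<Rightarrow> complex \<Rightarrow> complex)
     \<Rightarrow> ('i \<Rightarrow> complex \<Rightarrow> complex) \<Rightarrow> bool" where
  "euler_lagrange I U z h \<mu> \<longleftrightarrow>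
     (\<forall>i\<in>I. \<forall>\<zeta> \<in> z i ` U i. delbar (h i) \<zeta> = D_op (h i) (\<mu> i) \<zeta>)"

end

theory Submission
  imports Defs
begin

text \<open>
  In one chart write \<open>F\<close> for the local representative of the deformation map,
  \<open>\<partial>\<close> and \<open>\<partial>'\<close> for \<^const>\<open>del\<close> and \<^const>\<open>delbar\<close>, and
  \<open>\<mu> = \<partial>'F / \<partial>F\<close>.  The proof rests on the first-order operator \<open>L = \<partial>' - \<mu> \<partial>\<close>, which is
  a derivation and annihilates \<open>F\<close>.  It is the Cauchy-Riemann operator of the target surface,
  seen from the source: the chain rule gives
  \<open>L (H \<circ> F) = (\<partial>'H \<circ> F) J / \<partial>F\<close>, where the Jacobian determinant \<open>J = |\<partial>F|\<^sup>2 - |\<partial>'F|\<^sup>2\<close> is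
  positive because the map preserves orientation.  Hence \<open>H\<close> is holomorphic if and only if
  \<open>L (H \<circ> F) = 0\<close>.

  Second derivatives are symmetric, so \<open>L \<partial>u = \<partial> L u + \<partial>\<mu> \<partial>u\<close>.  Starting from \<open>L F = 0\<close>, three
  applications of this rule give \<open>L {F} = \<partial>\<^sup>3\<mu> + 2 \<partial>\<mu> {F}\<close> for the Schwarzian \<open>{F}\<close>
  (\<open>beltrami_op_schwarzian\<close>).  The push-forward is defined by
  \<open>(H \<circ> F) (\<partial>F)\<^sup>2 = h - {F}\<close>, and applying \<open>L\<close> to both sides makes all terms containing
  \<open>{F}\<close> cancel; what remains is
  \<open>(\<partial>'H \<circ> F) J \<partial>F = \<partial>'h - (\<partial>\<^sup>3\<mu> + 2 h \<partial>\<mu> + \<mu> \<partial>h)\<close> (\<open>delbar_push_forward\<close>).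
  So the Euler-Lagrange equation in a chart is the Cauchy-Riemann equation for \<open>H\<close>.

  Finally \<open>H\<close> must be a projective connection at all, that is, it must satisfy the
  transformation law (\<open>push_forward_transformation_law\<close>).  This follows by expanding the
  Schwarzian of the function \<open>F\<^sub>i \<circ> z\<^sub>i\<^sub>j = w\<^sub>i\<^sub>j \<circ> F\<^sub>j\<close> in two ways with the chain rule
  \<open>{u \<circ> v} = ({u} \<circ> v) (\<partial>v)\<^sup>2 + {v}\<close>, which survives for smooth functions as soon as one of
  \<open>u\<close>, \<open>v\<close> is holomorphic (\<open>schwarzian_compose\<close>).
\<close>
section \<open>Smooth functions on open sets\<close>

lemma frechet_derivative_cong_on_open:
  assumes "open S" "x \<in> S" "\<And>y. y \<in> S \<Longrightarrow> f y = g y"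
  shows "frechet_derivative f (at x) = frechet_derivative g (at x)"
proof -
  have "(f has_derivative D) (at x) \<longleftrightarrow> (g has_derivative D) (at x)" for D
    using assms has_derivative_transform_within_open[of f D x UNIV S g]
      has_derivative_transform_within_open[of g D x UNIV S f] by auto
  then show ?thesis
    unfolding frechet_derivative_def by simp
qed

text \<open>
  Derivatives at a point of an open set see only the values on that set.  This is what allows the
  closure properties below to be proved by computing a derivative on the set and substituting it.
\<close>
lemma Ck_on_cong_open:
  assumes "open S" "\<And>y. y \<in> S \<Longrightarrow> f y = g y" "Ck_on k f S"
  shows "Ck_on k g S"
  using assms(2,3)
proof (induction k arbitrary: f g)
  case 0
  then show ?case using continuous_on_cong by force
next
  case (Suc k)
  have "g differentiable at x" if "x \<in> S" for x
  proof -
    have "f differentiable at x" using Suc.prems that by simp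
    then show ?thesis
      using has_derivative_transform_within_open[of f _ x UNIV S g] assms(1) that Suc.prems(1)
      unfolding differentiable_def by blast
  qed
  moreover have "Ck_on k (\<lambda>x. frechet_derivative g (at x) v) S" for v
  proof (rule Suc.IH)
    show "Ck_on k (\<lambda>x. frechet_derivative f (at x) v) S" using Suc.prems by simp
    show "frechet_derivative f (at y) v = frechet_derivative g (at y) v" if "y \<in> S" for y
      using frechet_derivative_cong_on_open[OF assms(1) that] Suc.prems(1) by metis
  qed
  ultimately show ?case by simp
qed

lemma Ck_on_Suc_imp_Ck_on: "Ck_on (Suc k) f S \<Longrightarrow> Ck_on k f S"
proof (induction k arbitrary: f)
  case 0
  then show ?case
    by (auto intro!: continuous_at_imp_continuous_on differentiable_imp_continuous_within)
next
  case (Suc k)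
  then show ?case by simp
qed

text \<open>
  The induction step of every closure property: any family that is the derivative on \<open>S\<close> may
  stand in for \<^const>\<open>frechet_derivative\<close>.
\<close>
lemma Ck_on_SucI:
  assumes "open S"
    and "\<And>x. x \<in> S \<Longrightarrow> (f has_derivative D x) (at x)"
    and "\<And>v. Ck_on k (\<lambda>x. D x v) S"
  shows "Ck_on (Suc k) f S"
proof -
  have "f differentiable at x" if "x \<in> S" for x
    using assms(2)[OF that] differentiable_def by blast
  moreover have "Ck_on k (\<lambda>x. frechet_derivative f (at x) v) S" for v
    by (rule Ck_on_cong_open[OF assms(1) _ assms(3)[of v]])
      (simp add: frechet_derivative_at[OF assms(2)])
  ultimately show ?thesis by simp
qed

lemma Ck_on_SucD:
  assumes "Ck_on (Suc k) f S" "x \<in> S"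
  shows "(f has_derivative frechet_derivative f (at x)) (at x)"
  using assms frechet_derivative_works by auto

lemma Ck_on_const:
  assumes "open S"
  shows "Ck_on k (\<lambda>x. c) S"
proof (induction k arbitrary: c)
  case (Suc k)
  show ?case
    by (rule Ck_on_SucI[OF assms, where D = "\<lambda>x v. 0"]) (auto intro: Suc)
qed simp

lemma Ck_on_add:
  assumes "open S" "Ck_on k f S" "Ck_on k g S"
  shows "Ck_on k (\<lambda>x. f x + g x) S"
  using assms(2,3)
proof (induction k arbitrary: f g)
  case (Suc k)
  show ?case
    by (rule Ck_on_SucI[OF assms(1)], rule has_derivative_add)
      (use Suc in \<open>auto intro: Ck_on_SucD\<close>)
qed (auto intro: continuous_intros)

lemma Ck_on_mult:
  fixes f g :: "'a::real_normed_vector \<Rightarrow> 'b::real_normed_algebra"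
  assumes "open S" "Ck_on k f S" "Ck_on k g S"
  shows "Ck_on k (\<lambda>x. f x * g x) S"
  using assms(2,3)
proof (induction k arbitrary: f g)
  case (Suc k)
  have "Ck_on k f S" "Ck_on k g S"
    using Suc.prems Ck_on_Suc_imp_Ck_on by blast+
  then have D: "Ck_on k (\<lambda>x. f x * frechet_derivative g (at x) v + frechet_derivative f (at x) v * g x) S"
    for v
    using Suc.prems by (auto intro!: Ck_on_add[OF assms(1)] Suc.IH)
  show ?case
    by (rule Ck_on_SucI[OF assms(1) _ D,
          OF has_derivative_mult[OF Ck_on_SucD[OF Suc.prems(1)] Ck_on_SucD[OF Suc.prems(2)]]])
qed (auto intro: continuous_intros)

lemma Ck_on_inverse:
  fixes f :: "'a::real_normed_vector \<Rightarrow> 'b::real_normed_field"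
  assumes "open S" "Ck_on k f S" "\<And>x. x \<in> S \<Longrightarrow> f x \<noteq> 0"
  shows "Ck_on k (\<lambda>x. inverse (f x)) S"
  using assms(2,3)
proof (induction k arbitrary: f)
  case (Suc k)
  \<comment> \<open>The derivative of \<open>1/f\<close> again contains \<open>1/f\<close>, but only to one order of smoothness less.\<close>
  have *: "Ck_on k (\<lambda>x. inverse (f x)) S"
    using Suc Ck_on_Suc_imp_Ck_on by blast
  have "Ck_on k (\<lambda>x. (- 1) * (inverse (f x) * frechet_derivative f (at x) v * inverse (f x))) S" for v
    by (intro Ck_on_mult assms(1) * Ck_on_const) (use Suc.prems in auto)
  then have D: "Ck_on k (\<lambda>x. - (inverse (f x) * frechet_derivative f (at x) v * inverse (f x))) S" for v
    by simp
  show ?case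
    by (rule Ck_on_SucI[OF assms(1) _ D,
          OF Deriv.has_derivative_inverse[OF Suc.prems(2) Ck_on_SucD[OF Suc.prems(1)]]])
qed (auto intro: continuous_intros)

lemma smooth_on_cong:
  assumes "open S" "smooth_on f S" "\<And>y. y \<in> S \<Longrightarrow> g y = f y"
  shows "smooth_on g S"
  using assms unfolding smooth_on_def by (metis Ck_on_cong_open)

lemma Ck_on_subset: "Ck_on k f S \<Longrightarrow> T \<subseteq> S \<Longrightarrow> Ck_on k f T"
  by (induction k arbitrary: f) (auto intro: continuous_on_subset)

lemma smooth_on_subset: "smooth_on f S \<Longrightarrow> T \<subseteq> S \<Longrightarrow> smooth_on f T"
  by (auto simp: smooth_on_def intro: Ck_on_subset)

lemma smooth_on_const: "open S \<Longrightarrow> smooth_on (\<lambda>x. c) S"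
  by (simp add: smooth_on_def Ck_on_const)

lemma smooth_on_add:
  "open S \<Longrightarrow> smooth_on f S \<Longrightarrow> smooth_on g S \<Longrightarrow> smooth_on (\<lambda>x. f x + g x) S"
  by (simp add: smooth_on_def Ck_on_add)

lemma smooth_on_mult:
  fixes f g :: "'a::real_normed_vector \<Rightarrow> 'b::real_normed_algebra"
  shows "open S \<Longrightarrow> smooth_on f S \<Longrightarrow> smooth_on g S \<Longrightarrow> smooth_on (\<lambda>x. f x * g x) S"
  by (simp add: smooth_on_def Ck_on_mult)

lemma smooth_on_divide:
  fixes f g :: "'a::real_normed_vector \<Rightarrow> 'b::real_normed_field"
  assumes "open S" "smooth_on f S" "smooth_on g S" "\<And>x. x \<in> S \<Longrightarrow> g x \<noteq> 0"
  shows "smooth_on (\<lambda>x. f x / g x) S"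
  using assms by (simp add: smooth_on_def divide_inverse Ck_on_mult Ck_on_inverse)

lemma smooth_on_differentiable: "smooth_on f S \<Longrightarrow> x \<in> S \<Longrightarrow> f differentiable at x"
  unfolding smooth_on_def by (metis Ck_on.simps(2))

lemma smooth_on_continuous: "smooth_on f S \<Longrightarrow> continuous_on S f"
  unfolding smooth_on_def by (metis Ck_on.simps(1))

lemma smooth_on_frechet_derivative:
  "smooth_on f S \<Longrightarrow> smooth_on (\<lambda>x. frechet_derivative f (at x) v) S"
  unfolding smooth_on_def by (metis Ck_on.simps(2))

lemma holomorphic_on_imp_smooth_on:
  assumes "open S" "f holomorphic_on S"
  shows "smooth_on f S"
proof -
  have "Ck_on k f S" for k
    using assms(2)
  proof (induction k arbitrary: f)
    case 0
    then show ?case by (simp add: holomorphic_on_imp_continuous_on)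
  next
    case (Suc k)
    show ?case
    proof (rule Ck_on_SucI[OF assms(1)])
      show "(f has_derivative (*) (deriv f x)) (at x)" if "x \<in> S" for x
        using holomorphic_derivI[OF Suc.prems assms(1) that]
        by (simp add: has_field_derivative_def)
      show "Ck_on k (\<lambda>x. deriv f x * v) S" for v
        by (intro Ck_on_mult Ck_on_const assms(1) Suc.IH holomorphic_deriv Suc.prems)
    qed
  qed
  then show ?thesis by (simp add: smooth_on_def)
qed

section \<open>Symmetry of second derivatives\<close>

text \<open>
  The mean value theorem in direction \<open>v\<close> and then in direction \<open>w\<close> turns the second difference
  over a parallelogram into one value of a mixed derivative.  The second difference is symmetric
  in \<open>v\<close> and \<open>w\<close>, so it is also a value of the other mixed derivative; shrinking the
  parallelogram to a point then identifies the two by continuity.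
\<close>
lemma second_difference_mean_value:
  fixes f :: "'a::real_normed_vector \<Rightarrow> real"
  assumes "h > 0"
    and f: "\<And>s t. s \<in> {0..h} \<Longrightarrow> t \<in> {0..h} \<Longrightarrow>
        (f has_derivative D (x + s *\<^sub>R v + t *\<^sub>R w)) (at (x + s *\<^sub>R v + t *\<^sub>R w))"
    and D: "\<And>s t. s \<in> {0..h} \<Longrightarrow> t \<in> {0..h} \<Longrightarrow>
        ((\<lambda>y. D y v) has_derivative E (x + s *\<^sub>R v + t *\<^sub>R w)) (at (x + s *\<^sub>R v + t *\<^sub>R w))"
  obtains s t where "s \<in> {0..h}" "t \<in> {0..h}"
    "f (x + h *\<^sub>R v + h *\<^sub>R w) - f (x + h *\<^sub>R v) - f (x + h *\<^sub>R w) + f x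
       = h * h * E (x + s *\<^sub>R v + t *\<^sub>R w) w"
proof -
  define p where "p = (\<lambda>s. f (x + s *\<^sub>R v + h *\<^sub>R w) - f (x + s *\<^sub>R v + 0 *\<^sub>R w))"
  have lin: "linear (D (x + s *\<^sub>R v + t *\<^sub>R w))" if "s \<in> {0..h}" "t \<in> {0..h}" for s t
    using f[OF that] has_derivative_linear by blast
  have linE: "linear (E (x + s *\<^sub>R v + t *\<^sub>R w))" if "s \<in> {0..h}" "t \<in> {0..h}" for s t
    using D[OF that] has_derivative_linear by blast
  have path: "((\<lambda>s. x + s *\<^sub>R v + t *\<^sub>R w) has_derivative (\<lambda>r. r *\<^sub>R v)) (at s within A)" for s t A
    by (auto intro!: derivative_eq_intros)
  have path': "((\<lambda>t. x + s *\<^sub>R v + t *\<^sub>R w) has_derivative (\<lambda>r. r *\<^sub>R w)) (at t within A)" for s t A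
    by (auto intro!: derivative_eq_intros)
  have along: "((\<lambda>s. f (x + s *\<^sub>R v + t *\<^sub>R w)) has_derivative
      (\<lambda>r. D (x + s *\<^sub>R v + t *\<^sub>R w) (r *\<^sub>R v))) (at s within {0..h})"
    if "s \<in> {0..h}" "t \<in> {0..h}" for s t
    using has_derivative_compose[OF path f[OF that]] .
  have "(p has_derivative (\<lambda>r. D (x + s *\<^sub>R v + h *\<^sub>R w) (r *\<^sub>R v) - D (x + s *\<^sub>R v + 0 *\<^sub>R w) (r *\<^sub>R v)))
      (at s within {0..h})" if "s \<in> {0..h}" for s
    unfolding p_def by (intro has_derivative_diff along) (use that \<open>h > 0\<close> in auto)
  from mvt_simple[OF \<open>h > 0\<close> this] obtain s where s: "s \<in> {0<..<h}"
    and ps: "p h - p 0 = D (x + s *\<^sub>R v + h *\<^sub>R w) ((h - 0) *\<^sub>R v) - D (x + s *\<^sub>R v + 0 *\<^sub>R w) ((h - 0) *\<^sub>R v)"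
    by auto
  have s': "s \<in> {0..h}" using s by auto
  have "((\<lambda>t. D (x + s *\<^sub>R v + t *\<^sub>R w) v) has_derivative
      (\<lambda>r. E (x + s *\<^sub>R v + t *\<^sub>R w) (r *\<^sub>R w))) (at t within {0..h})"
    if "t \<in> {0..h}" for t
    using has_derivative_compose[OF path' D[OF s' that]] .
  from mvt_simple[OF \<open>h > 0\<close> this] obtain t where t: "t \<in> {0<..<h}"
    and qt: "D (x + s *\<^sub>R v + h *\<^sub>R w) v - D (x + s *\<^sub>R v + 0 *\<^sub>R w) v
      = E (x + s *\<^sub>R v + t *\<^sub>R w) ((h - 0) *\<^sub>R w)"
    by auto
  have t': "t \<in> {0..h}" using t by auto
  have "p h - p 0 = h * (D (x + s *\<^sub>R v + h *\<^sub>R w) v - D (x + s *\<^sub>R v + 0 *\<^sub>R w) v)"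
    unfolding ps using lin[OF s', of h] lin[OF s', of 0] \<open>h > 0\<close>
    by (simp add: linear_cmul algebra_simps)
  also have "\<dots> = h * h * E (x + s *\<^sub>R v + t *\<^sub>R w) w"
    unfolding qt using linE[OF s' t'] by (simp add: linear_cmul)
  finally show ?thesis
    using that[OF s' t'] by (simp add: p_def)
qed

lemma second_derivative_symmetric_real:
  fixes f :: "'a::real_normed_vector \<Rightarrow> real"
  assumes "open S" "x \<in> S"
    and f: "\<And>y. y \<in> S \<Longrightarrow> (f has_derivative D y) (at y)"
    and Dv: "\<And>y. y \<in> S \<Longrightarrow> ((\<lambda>y. D y v) has_derivative E y) (at y)"
    and Dw: "\<And>y. y \<in> S \<Longrightarrow> ((\<lambda>y. D y w) has_derivative G y) (at y)"
    and cont: "continuous_on S (\<lambda>y. E y w)" "continuous_on S (\<lambda>y. G y v)"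
  shows "E x w = G x v"
proof (rule ccontr)
  assume neq: "E x w \<noteq> G x v"
  \<comment> \<open>Half the gap: the balls of radius \<open>e\<close> around the two mixed derivatives are disjoint.\<close>
  define e where "e = \<bar>E x w - G x v\<bar> / 2"
  have "e > 0" using neq by (simp add: e_def)
  have "\<forall>\<^sub>F y in at x. dist (E y w) (E x w) < e" "\<forall>\<^sub>F y in at x. dist (G y v) (G x v) < e"
    using cont assms(1,2) \<open>e > 0\<close> unfolding continuous_on_eq_continuous_at[OF assms(1)]
    by (auto simp: isCont_def tendsto_iff)
  then have "\<forall>\<^sub>F y in at x. dist (E y w) (E x w) < e \<and> dist (G y v) (G x v) < e \<and> y \<in> S"
    using eventually_at_in_open'[OF assms(1,2)] by eventually_elim auto
  then obtain d where "d > 0"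
    and d': "\<And>y. y \<noteq> x \<Longrightarrow> dist y x < d \<Longrightarrow>
      dist (E y w) (E x w) < e \<and> dist (G y v) (G x v) < e \<and> y \<in> S"
    unfolding eventually_at by auto
  have d: "dist (E y w) (E x w) < e \<and> dist (G y v) (G x v) < e \<and> y \<in> S" if "dist y x < d" for y
    using d'[of y] that \<open>e > 0\<close> assms(2) by (cases "y = x") auto
  \<comment> \<open>The summand 1 keeps \<open>N\<close> positive when both directions vanish; the side length \<open>h\<close> keeps
    the whole parallelogram within distance \<open>d/2\<close> of \<open>x\<close>.\<close>
  define N where "N = norm v + norm w + 1"
  define h where "h = d / (2 * N)"
  have "N > 0" by (simp add: N_def add_nonneg_pos)
  then have "h > 0" using \<open>d > 0\<close> by (simp add: h_def)
  have near: "dist (x + s *\<^sub>R v + t *\<^sub>R w) x < d" if "s \<in> {0..h}" "t \<in> {0..h}" for s t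
  proof -
    have "norm (s *\<^sub>R v + t *\<^sub>R w) \<le> s * norm v + t * norm w"
      using norm_triangle_ineq[of "s *\<^sub>R v" "t *\<^sub>R w"] that by auto
    also have "\<dots> \<le> h * norm v + h * norm w"
      using that by (intro add_mono mult_right_mono) auto
    also have "\<dots> \<le> h * N"
      using \<open>h > 0\<close> by (simp add: N_def algebra_simps)
    also have "\<dots> = d / 2"
      using \<open>N > 0\<close> by (simp add: h_def)
    finally show ?thesis using \<open>d > 0\<close> by (simp add: dist_norm add.assoc)
  qed
  have near': "dist (x + s *\<^sub>R w + t *\<^sub>R v) x < d" if "s \<in> {0..h}" "t \<in> {0..h}" for s t
    using near[OF that(2,1)] by (simp add: add_ac)
  obtain s t where st: "s \<in> {0..h}" "t \<in> {0..h}"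
    "f (x + h *\<^sub>R v + h *\<^sub>R w) - f (x + h *\<^sub>R v) - f (x + h *\<^sub>R w) + f x
       = h * h * E (x + s *\<^sub>R v + t *\<^sub>R w) w"
    by (rule second_difference_mean_value[OF \<open>h > 0\<close>, of f D x v w E])
      (use f Dv d near in blast)+
  obtain s' t' where st': "s' \<in> {0..h}" "t' \<in> {0..h}"
    "f (x + h *\<^sub>R w + h *\<^sub>R v) - f (x + h *\<^sub>R w) - f (x + h *\<^sub>R v) + f x
       = h * h * G (x + s' *\<^sub>R w + t' *\<^sub>R v) v"
    by (rule second_difference_mean_value[OF \<open>h > 0\<close>, of f D x w v G])
      (use f Dw d near' in blast)+
  have "h * h * E (x + s *\<^sub>R v + t *\<^sub>R w) w = h * h * G (x + s' *\<^sub>R w + t' *\<^sub>R v) v"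
    using st(3) st'(3) add.commute[of "h *\<^sub>R w" "h *\<^sub>R v"] by (simp only: add.assoc)
  then have "E (x + s *\<^sub>R v + t *\<^sub>R w) w = G (x + s' *\<^sub>R w + t' *\<^sub>R v) v"
    using \<open>h > 0\<close> by simp
  moreover have "dist (E (x + s *\<^sub>R v + t *\<^sub>R w) w) (E x w) < e"
    using d near[OF st(1,2)] by blast
  moreover have "dist (G (x + s' *\<^sub>R w + t' *\<^sub>R v) v) (G x v) < e"
    using d near'[OF st'(1,2)] by blast
  ultimately show False
    unfolding e_def dist_real_def by argo
qed

lemma smooth_on_second_derivative_symmetric:
  fixes f :: "'a::real_normed_vector \<Rightarrow> 'b::real_inner"
  assumes "open S" "x \<in> S" "smooth_on f S"
  shows "frechet_derivative (\<lambda>y. frechet_derivative f (at y) v) (at x) w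
       = frechet_derivative (\<lambda>y. frechet_derivative f (at y) w) (at x) v" (is "?l = ?r")
proof -
  have der: "(u has_derivative frechet_derivative u (at y)) (at y)"
    if "smooth_on u S" "y \<in> S" for u :: "'a \<Rightarrow> 'b" and y
    using smooth_on_differentiable[OF that] frechet_derivative_works by blast
  note sm = smooth_on_frechet_derivative
  have "b \<bullet> ?l = b \<bullet> ?r" for b
    by (rule second_derivative_symmetric_real[OF assms(1,2), where f = "\<lambda>y. b \<bullet> f y"
          and D = "\<lambda>y u. b \<bullet> frechet_derivative f (at y) u"
          and E = "\<lambda>y u. b \<bullet> frechet_derivative (\<lambda>y. frechet_derivative f (at y) v) (at y) u"
          and G = "\<lambda>y u. b \<bullet> frechet_derivative (\<lambda>y. frechet_derivative f (at y) w) (at y) u"])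
      (intro has_derivative_inner_right der assms sm
         continuous_on_inner[OF continuous_on_const smooth_on_continuous]; assumption)+
  then show ?thesis using vector_eq_ldot by blast
qed

section \<open>Wirtinger calculus\<close>

text \<open>
  Every real-linear map of the plane is \<open>v \<mapsto> a v + b v'\<close> with \<open>v'\<close> the conjugate of \<open>v\<close>.  Stating
  differentiability together with the coefficients \<open>a\<close>, \<open>b\<close> lets the usual rules for Frechet
  derivatives be read off for both Wirtinger derivatives at once.
\<close>
definition has_wirtinger_derivs ::
  "(complex \<Rightarrow> complex) \<Rightarrow> complex \<Rightarrow> complex \<Rightarrow> complex \<Rightarrow> bool" where
  "has_wirtinger_derivs f a b x \<longleftrightarrow> (f has_derivative (\<lambda>v. a * v + b * cnj v)) (at x)"

lemma differentiable_imp_has_wirtinger_derivs: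
  assumes "f differentiable at x"
  shows "has_wirtinger_derivs f (del f x) (delbar f x) x"
proof -
  let ?D = "frechet_derivative f (at x)"
  have D: "(f has_derivative ?D) (at x)" using assms frechet_derivative_works by blast
  have "?D v = del f x * v + delbar f x * cnj v" for v
  proof -
    have "?D v = ?D (Re v *\<^sub>R 1 + Im v *\<^sub>R \<i>)"
      by (metis complex_eq mult.commute mult.right_neutral scaleR_conv_of_real)
    also have "\<dots> = Re v *\<^sub>R ?D 1 + Im v *\<^sub>R ?D \<i>"
      using has_derivative_linear[OF D] by (simp only: linear_add linear_cmul)
    also have "\<dots> = del f x * v + delbar f x * cnj v"
      by (simp add: del_def delbar_def partial_x_def partial_y_def complex_eq_iff field_simps)
    finally show ?thesis .
  qed
  then have "?D = (\<lambda>v. del f x * v + delbar f x * cnj v)" by blast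
  with D show ?thesis by (metis has_wirtinger_derivs_def)
qed

lemma has_wirtinger_derivs_imp:
  assumes "has_wirtinger_derivs f a b x"
  shows "del f x = a" "delbar f x = b" "f differentiable at x"
proof -
  have D: "(f has_derivative (\<lambda>v. a * v + b * cnj v)) (at x)"
    using assms by (simp add: has_wirtinger_derivs_def)
  show "f differentiable at x" using D differentiable_def by blast
  have "frechet_derivative f (at x) = (\<lambda>v. a * v + b * cnj v)"
    using frechet_derivative_at[OF D] by simp
  then show "del f x = a" "delbar f x = b"
    by (simp_all add: del_def delbar_def partial_x_def partial_y_def field_simps)
qed

lemma has_wirtinger_derivs_mult:
  assumes "has_wirtinger_derivs f a b x" "has_wirtinger_derivs g c d x"
  shows "has_wirtinger_derivs (\<lambda>y. f y * g y) (a * g x + f x * c) (b * g x + f x * d) x"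
  using has_derivative_mult[OF assms[unfolded has_wirtinger_derivs_def]]
  unfolding has_wirtinger_derivs_def
  by (rule has_derivative_eq_rhs) (simp add: algebra_simps)

lemma has_wirtinger_derivs_divide:
  assumes "has_wirtinger_derivs f a b x" "has_wirtinger_derivs g c d x" "g x \<noteq> 0"
  shows "has_wirtinger_derivs (\<lambda>y. f y / g y)
    ((a * g x - f x * c) / (g x)\<^sup>2) ((b * g x - f x * d) / (g x)\<^sup>2) x"
  using has_derivative_divide'[OF assms(1,2)[unfolded has_wirtinger_derivs_def] assms(3)]
  unfolding has_wirtinger_derivs_def
  by (rule has_derivative_eq_rhs)
    (use assms(3) in \<open>simp add: fun_eq_iff field_simps power2_eq_square\<close>)

lemma has_wirtinger_derivs_add:
  assumes "has_wirtinger_derivs f a b x" "has_wirtinger_derivs g c d x"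
  shows "has_wirtinger_derivs (\<lambda>y. f y + g y) (a + c) (b + d) x"
  using has_derivative_add[OF assms[unfolded has_wirtinger_derivs_def]]
  unfolding has_wirtinger_derivs_def
  by (rule has_derivative_eq_rhs) (simp add: algebra_simps)

lemma has_wirtinger_derivs_diff:
  assumes "has_wirtinger_derivs f a b x" "has_wirtinger_derivs g c d x"
  shows "has_wirtinger_derivs (\<lambda>y. f y - g y) (a - c) (b - d) x"
  using has_derivative_diff[OF assms[unfolded has_wirtinger_derivs_def]]
  unfolding has_wirtinger_derivs_def
  by (rule has_derivative_eq_rhs) (simp add: algebra_simps)

lemma has_wirtinger_derivs_const: "has_wirtinger_derivs (\<lambda>y. k) 0 0 x"
  unfolding has_wirtinger_derivs_def by simp

lemma has_wirtinger_derivs_compose: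
  assumes "has_wirtinger_derivs f a b x" "has_wirtinger_derivs g c d (f x)"
  shows "has_wirtinger_derivs (g \<circ> f) (c * a + d * cnj b) (c * b + d * cnj a) x"
  using diff_chain_at[OF assms[unfolded has_wirtinger_derivs_def]]
  unfolding has_wirtinger_derivs_def
  by (rule has_derivative_eq_rhs) (simp add: fun_eq_iff algebra_simps)

lemma field_derivative_imp_has_wirtinger_derivs:
  assumes "(f has_field_derivative a) (at x)"
  shows "has_wirtinger_derivs f a 0 x"
  using assms by (simp add: has_wirtinger_derivs_def has_field_derivative_def)

lemma holomorphic_on_imp_del_eq_deriv:
  assumes "f holomorphic_on S" "open S" "x \<in> S"
  shows "del f x = deriv f x" "delbar f x = 0"
  using has_wirtinger_derivs_imp[OF field_derivative_imp_has_wirtinger_derivs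
      [OF holomorphic_derivI[OF assms]]] by auto

lemma cauchy_riemann_imp_holomorphic_on:
  assumes "open S" "\<And>x. x \<in> S \<Longrightarrow> f differentiable at x" "\<And>x. x \<in> S \<Longrightarrow> delbar f x = 0"
  shows "f holomorphic_on S"
proof -
  have "(f has_field_derivative del f x) (at x)" if "x \<in> S" for x
    using differentiable_imp_has_wirtinger_derivs[OF assms(2)[OF that]] assms(3)[OF that]
    by (simp add: has_wirtinger_derivs_def has_field_derivative_def)
  then show ?thesis using assms(1) holomorphic_on_open by blast
qed

lemma del_cong_on_open:
  assumes "open S" "x \<in> S" "\<And>y. y \<in> S \<Longrightarrow> f y = g y"
  shows "del f x = del g x" "delbar f x = delbar g x"
  using frechet_derivative_cong_on_open[OF assms]
  by (simp_all add: del_def delbar_def partial_x_def partial_y_def)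

lemma smooth_on_del:
  assumes "open S" "smooth_on f S"
  shows "smooth_on (del f) S" "smooth_on (delbar f) S"
proof -
  have "smooth_on (\<lambda>x. frechet_derivative f (at x) 1 * (1/2) + frechet_derivative f (at x) \<i> * c) S"
    for c
    by (intro smooth_on_add smooth_on_mult smooth_on_frechet_derivative smooth_on_const assms)
  note comb = this
  show "smooth_on (del f) S"
    by (rule smooth_on_cong[OF assms(1) comb[of "-\<i>/2"]])
      (simp add: del_def partial_x_def partial_y_def field_simps)
  show "smooth_on (delbar f) S"
    by (rule smooth_on_cong[OF assms(1) comb[of "\<i>/2"]])
      (simp add: delbar_def partial_x_def partial_y_def field_simps)
qed

text \<open>
  Both sides are a quarter of the Laplacian, plus a multiple of the difference of the mixed real
  derivatives, which vanishes.
\<close>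
lemma delbar_del_commute:
  assumes "open S" "smooth_on f S" "x \<in> S"
  shows "delbar (del f) x = del (delbar f) x"
proof -
  let ?X = "partial_x f" and ?Y = "partial_y f"
  have sX: "smooth_on ?X S" and sY: "smooth_on ?Y S"
    using smooth_on_frechet_derivative[OF assms(2)]
    by (simp_all add: partial_x_def[abs_def] partial_y_def[abs_def])
  note wX = differentiable_imp_has_wirtinger_derivs[OF smooth_on_differentiable[OF sX assms(3)]]
  note wY = differentiable_imp_has_wirtinger_derivs[OF smooth_on_differentiable[OF sY assms(3)]]
  have comb: "has_wirtinger_derivs (\<lambda>y. ?X y * k + ?Y y * c)
      (del ?X x * k + del ?Y x * c) (delbar ?X x * k + delbar ?Y x * c) x" for k c
    using has_wirtinger_derivs_add[OF
        has_wirtinger_derivs_mult[OF wX has_wirtinger_derivs_const[of k]]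
        has_wirtinger_derivs_mult[OF wY has_wirtinger_derivs_const[of c]]] by simp
  have e: "del f = (\<lambda>y. ?X y * (1/2) + ?Y y * (-\<i>/2))"
    "delbar f = (\<lambda>y. ?X y * (1/2) + ?Y y * (\<i>/2))"
    by (simp_all add: del_def delbar_def fun_eq_iff field_simps)
  have sym: "partial_y ?X x = partial_x ?Y x"
    using smooth_on_second_derivative_symmetric[OF assms(1,3,2), of 1 \<i>]
    by (simp add: partial_x_def[abs_def] partial_y_def[abs_def])
  show ?thesis
    unfolding e has_wirtinger_derivs_imp(1)[OF comb] has_wirtinger_derivs_imp(2)[OF comb]
    using sym by (simp add: del_def delbar_def field_simps)
qed


section \<open>The Schwarzian derivative\<close>

lemma holomorphic_on_del:
  assumes "open S" "u holomorphic_on S"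
  shows "del u holomorphic_on S"
  using holomorphic_deriv[OF assms(2,1)] holomorphic_on_imp_del_eq_deriv[OF assms(2,1)]
  by (metis (no_types, lifting) holomorphic_cong)

text \<open>
  In general \<open>\<partial>(u \<circ> v)\<close> has a second term, the product of \<open>\<partial>'u\<close> at \<open>v x\<close> and the conjugate of
  \<open>\<partial>'v x\<close>.
\<close>
lemma del_compose:
  assumes "v differentiable at x" "u differentiable at (v x)"
    and "delbar v x = 0 \<or> delbar u (v x) = 0"
  shows "del (u \<circ> v) x = del u (v x) * del v x"
  using has_wirtinger_derivs_imp(1)[OF has_wirtinger_derivs_compose
      [OF assms(1,2)[THEN differentiable_imp_has_wirtinger_derivs]]] assms(3) by auto

text \<open>
  The classical computation uses only \<open>\<partial>(\<phi> \<circ> v) = (\<partial>\<phi> \<circ> v) \<partial>v\<close> for \<open>\<phi>\<close> among \<open>u\<close>, \<open>\<partial>u\<close>,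
  \<open>\<partial>\<^sup>2u\<close>.  This holds if \<open>v\<close> is holomorphic, and also if \<open>u\<close> is, because then its derivatives
  are holomorphic too.  The first case serves for coordinate changes on the source surface, the
  second for those on the target.
\<close>
lemma schwarzian_compose:
  assumes "open R" "open S" "v ` R \<subseteq> S"
    and v: "smooth_on v R" and u: "smooth_on u S"
    and hol: "v holomorphic_on R \<or> u holomorphic_on S"
    and nz: "\<And>x. x \<in> R \<Longrightarrow> del v x \<noteq> 0" "\<And>y. y \<in> S \<Longrightarrow> del u y \<noteq> 0"
    and "x \<in> R"
  shows "schwarzian (u \<circ> v) x = schwarzian u (v x) * (del v x)\<^sup>2 + schwarzian v x"
proof -
  note W = differentiable_imp_has_wirtinger_derivs[OF smooth_on_differentiable]
  have chain: "has_wirtinger_derivs (\<lambda>y. \<phi> (v y)) (del \<phi> (v y) * del v y) (delbar (\<phi> \<circ> v) y) y"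
    if "smooth_on \<phi> S" "v holomorphic_on R \<or> \<phi> holomorphic_on S" "y \<in> R" for \<phi> y
  proof -
    have "v y \<in> S" using that assms(3) by auto
    then have d: "\<phi> differentiable at (v y)" "v differentiable at y"
      using that v smooth_on_differentiable by blast+
    have "delbar v y = 0 \<or> delbar \<phi> (v y) = 0"
      using that holomorphic_on_imp_del_eq_deriv(2) \<open>v y \<in> S\<close> assms(1,2) by blast
    from del_compose[OF d(2,1) this] show ?thesis
      using differentiable_imp_has_wirtinger_derivs[OF differentiable_chain_at[OF d(2,1)]]
      by (simp add: o_def)
  qed
  let ?u1 = "del u" and ?u2 = "del (del u)" and ?v1 = "del v" and ?v2 = "del (del v)"
  have u12: "smooth_on ?u1 S" "smooth_on ?u2 S" and v12: "smooth_on ?v1 R" "smooth_on ?v2 R"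
    using smooth_on_del(1) u v assms(1,2) by blast+
  have h1: "v holomorphic_on R \<or> ?u1 holomorphic_on S"
    and h2: "v holomorphic_on R \<or> ?u2 holomorphic_on S"
    using hol holomorphic_on_del[OF assms(2)] by blast+
  have d1: "del (u \<circ> v) y = ?u1 (v y) * ?v1 y" if "y \<in> R" for y
    using has_wirtinger_derivs_imp(1)[OF chain[OF u hol that]] by (simp add: o_def)
  have d1': "del (del (u \<circ> v)) y = del (\<lambda>y. ?u1 (v y) * ?v1 y) y" if "y \<in> R" for y
    by (rule del_cong_on_open(1)[OF assms(1) that d1])
  have d2: "del (del (u \<circ> v)) y = ?u2 (v y) * (?v1 y)\<^sup>2 + ?u1 (v y) * ?v2 y" if "y \<in> R" for y
    unfolding d1'[OF that]
      has_wirtinger_derivs_imp(1)[OF has_wirtinger_derivs_mult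
        [OF chain[OF u12(1) h1 that] W[OF v12(1) that]]]
    by (simp add: power2_eq_square)
  have d2': "del (del (del (u \<circ> v))) x
      = del (\<lambda>y. ?u2 (v y) * (?v1 y * ?v1 y) + ?u1 (v y) * ?v2 y) x"
    by (rule del_cong_on_open(1)[OF assms(1) \<open>x \<in> R\<close> d2[unfolded power2_eq_square]])
  have d3: "del (del (del (u \<circ> v))) x = del ?u2 (v x) * (?v1 x) ^ 3
      + 3 * ?u2 (v x) * ?v1 x * ?v2 x + ?u1 (v x) * del ?v2 x"
    unfolding d2'
      has_wirtinger_derivs_imp(1)[OF has_wirtinger_derivs_add[OF
          has_wirtinger_derivs_mult[OF chain[OF u12(2) h2 \<open>x \<in> R\<close>]
            has_wirtinger_derivs_mult[OF W[OF v12(1) \<open>x \<in> R\<close>] W[OF v12(1) \<open>x \<in> R\<close>]]]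
          has_wirtinger_derivs_mult[OF chain[OF u12(1) h1 \<open>x \<in> R\<close>] W[OF v12(2) \<open>x \<in> R\<close>]]]]
    by (simp add: power3_eq_cube algebra_simps)
  have "?v1 x \<noteq> 0" "?u1 (v x) \<noteq> 0" using nz assms(3) \<open>x \<in> R\<close> by auto
  then show ?thesis
    unfolding schwarzian_def d1[OF \<open>x \<in> R\<close>] d2[OF \<open>x \<in> R\<close>] d3
    by (simp add: field_simps power2_eq_square power3_eq_cube)
qed

lemma schwarzian_cong_on_open:
  assumes "open S" "x \<in> S" "\<And>y. y \<in> S \<Longrightarrow> f y = g y"
  shows "schwarzian f x = schwarzian g x"
proof -
  have 1: "del f y = del g y" if "y \<in> S" for y
    using del_cong_on_open(1)[OF assms(1) that assms(3)] .
  have 2: "del (del f) y = del (del g) y" if "y \<in> S" for y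
    using del_cong_on_open(1)[OF assms(1) that 1] .
  have 3: "del (del (del f)) x = del (del (del g)) x"
    using del_cong_on_open(1)[OF assms(1,2) 2] .
  show ?thesis by (simp add: schwarzian_def 1 2 3 assms(2))
qed

lemma smooth_on_schwarzian:
  assumes "open S" "smooth_on F S" "\<And>x. x \<in> S \<Longrightarrow> del F x \<noteq> 0"
  shows "smooth_on (schwarzian F) S"
proof -
  have "smooth_on (\<lambda>x. del (del (del F)) x / del F x +
      (-3/2) * ((del (del F) x / del F x) * (del (del F) x / del F x))) S"
    by (intro smooth_on_add smooth_on_mult smooth_on_divide smooth_on_const smooth_on_del assms)
  then show ?thesis
    by (rule smooth_on_cong[OF assms(1)]) (simp add: schwarzian_def power2_eq_square)
qed

section \<open>The Beltrami operator\<close>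

text \<open>
  The solutions of \<open>beltrami_op \<mu> u = 0\<close> are the functions that are holomorphic for the complex
  structure with Beltrami coefficient \<open>\<mu>\<close>.
\<close>
definition beltrami_op :: "(complex \<Rightarrow> complex) \<Rightarrow> (complex \<Rightarrow> complex) \<Rightarrow> complex \<Rightarrow> complex" where
  "beltrami_op \<mu> u x = delbar u x - \<mu> x * del u x"

lemma beltrami_op_diff:
  assumes "u differentiable at x" "v differentiable at x"
  shows "beltrami_op \<mu> (\<lambda>y. u y - v y) x = beltrami_op \<mu> u x - beltrami_op \<mu> v x"
  unfolding beltrami_op_def has_wirtinger_derivs_imp(1,2)[OF has_wirtinger_derivs_diff
      [OF assms[THEN differentiable_imp_has_wirtinger_derivs]]]
  by (simp add: algebra_simps)

lemma beltrami_op_mult: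
  assumes "u differentiable at x" "v differentiable at x"
  shows "beltrami_op \<mu> (\<lambda>y. u y * v y) x = beltrami_op \<mu> u x * v x + u x * beltrami_op \<mu> v x"
  unfolding beltrami_op_def has_wirtinger_derivs_imp(1,2)[OF has_wirtinger_derivs_mult
      [OF assms[THEN differentiable_imp_has_wirtinger_derivs]]]
  by (simp add: algebra_simps)

lemma beltrami_op_divide:
  assumes "u differentiable at x" "v differentiable at x" "v x \<noteq> 0"
  shows "beltrami_op \<mu> (\<lambda>y. u y / v y) x
    = (beltrami_op \<mu> u x * v x - u x * beltrami_op \<mu> v x) / (v x)\<^sup>2"
  unfolding beltrami_op_def has_wirtinger_derivs_imp(1,2)[OF has_wirtinger_derivs_divide
      [OF assms(1,2)[THEN differentiable_imp_has_wirtinger_derivs] assms(3)]]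
  using assms(3) by (simp add: field_simps power2_eq_square)

lemma beltrami_op_cong_on_open:
  assumes "open S" "x \<in> S" "\<And>y. y \<in> S \<Longrightarrow> f y = g y"
  shows "beltrami_op \<mu> f x = beltrami_op \<mu> g x"
  by (simp add: beltrami_op_def del_cong_on_open[OF assms])

text \<open>
  When \<open>F\<close> solves the Beltrami equation only the second term survives, so up to a factor the
  operator computes \<open>\<partial>'\<phi>\<close> in the coordinate \<open>F\<close>.
\<close>
lemma beltrami_op_compose:
  assumes "F differentiable at x" "\<phi> differentiable at (F x)"
  shows "beltrami_op \<mu> (\<phi> \<circ> F) x = del \<phi> (F x) * beltrami_op \<mu> F x
    + delbar \<phi> (F x) * (cnj (del F x) - \<mu> x * cnj (delbar F x))"
  using has_wirtinger_derivs_imp[OF has_wirtinger_derivs_compose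
      [OF assms[THEN differentiable_imp_has_wirtinger_derivs]]]
  by (simp add: beltrami_op_def algebra_simps)

lemma beltrami_op_del:
  assumes "open S" "x \<in> S" "smooth_on u S" "smooth_on \<mu> S"
  shows "beltrami_op \<mu> (del u) x = del (beltrami_op \<mu> u) x + del \<mu> x * del u x"
proof -
  note W = differentiable_imp_has_wirtinger_derivs[OF smooth_on_differentiable[OF _ assms(2)]]
  note su = smooth_on_del[OF assms(1,3)]
  have "del (beltrami_op \<mu> u) x = del (delbar u) x - (del \<mu> x * del u x + \<mu> x * del (del u) x)"
    using has_wirtinger_derivs_imp(1)[OF has_wirtinger_derivs_diff[OF W[OF su(2)]
        has_wirtinger_derivs_mult[OF W[OF assms(4)] W[OF su(1)]]]]
    by (simp add: beltrami_op_def[abs_def])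
  then show ?thesis
    by (simp add: beltrami_op_def delbar_del_commute[OF assms(1,3,2)])
qed

lemma jacobian_det_eq: "of_real (jacobian_det f x) = del f x * cnj (del f x) - delbar f x * cnj (delbar f x)"
  by (simp add: jacobian_det_def del_def delbar_def complex_eq_iff field_simps)

lemma jacobian_det_pos_imp_del_nonzero:
  assumes "jacobian_det f x > 0"
  shows "del f x \<noteq> 0"
proof
  assume "del f x = 0"
  then have "complex_of_real (jacobian_det f x) = - of_real ((cmod (delbar f x))\<^sup>2)"
    by (simp add: jacobian_det_eq flip: complex_norm_square)
  then have "jacobian_det f x = - (cmod (delbar f x))\<^sup>2"
    by (metis of_real_eq_iff of_real_minus)
  then show False using assms by (smt (verit) zero_le_power2)
qed

text \<open>
  Each further derivative of \<open>F\<close> costs one commutator term \<open>\<partial>\<mu> \<partial>u\<close>.  Infinitesimally this is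
  the chain rule for the Schwarzian: \<open>\<mu>\<close> acts as a vector field, \<open>2 \<partial>\<mu> {F}\<close> comes from the factor
  \<open>(\<partial>v)\<^sup>2\<close> there, and \<open>\<partial>\<^sup>3\<mu>\<close> is the linearisation of \<open>{v}\<close> at the identity.
\<close>
lemma beltrami_op_schwarzian:
  assumes "open S" "x \<in> S"
    and F: "smooth_on F S" and \<mu>: "smooth_on \<mu> S"
    and nz: "\<And>y. y \<in> S \<Longrightarrow> del F y \<noteq> 0"
    and eq: "\<And>y. y \<in> S \<Longrightarrow> beltrami_op \<mu> F y = 0"
  shows "beltrami_op \<mu> (del F) x = del \<mu> x * del F x"
    and "beltrami_op \<mu> (schwarzian F) x = del (del (del \<mu>)) x + 2 * del \<mu> x * schwarzian F x"
proof -
  let ?L = "beltrami_op \<mu>"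
  define p p1 p2 m1 m2 where defs: "p = del F" "p1 = del p" "p2 = del p1" "m1 = del \<mu>" "m2 = del m1"
  have sm: "smooth_on p S" "smooth_on p1 S" "smooth_on p2 S" "smooth_on m1 S" "smooth_on m2 S"
    unfolding defs using F \<mu> smooth_on_del(1)[OF assms(1)] by blast+
  note W = differentiable_imp_has_wirtinger_derivs[OF smooth_on_differentiable]
  have "del (?L F) y = del (\<lambda>y. 0) y" if "y \<in> S" for y
    by (rule del_cong_on_open(1)[OF assms(1) that eq])
  then have LF: "del (?L F) y = 0" if "y \<in> S" for y
    using that by (simp add: has_wirtinger_derivs_imp(1)[OF has_wirtinger_derivs_const])
  have Lp: "?L p y = m1 y * p y" if "y \<in> S" for y
    using beltrami_op_del[OF assms(1) that F \<mu>] LF[OF that] by (simp add: defs)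
  have DLp: "del (?L p) y = del (\<lambda>y. m1 y * p y) y" if "y \<in> S" for y
    by (rule del_cong_on_open(1)[OF assms(1) that Lp])
  have Lp1: "?L p1 y = m2 y * p y + 2 * m1 y * p1 y" if "y \<in> S" for y
    unfolding defs(2) beltrami_op_del[OF assms(1) that sm(1) \<mu>] DLp[OF that]
      has_wirtinger_derivs_imp(1)[OF has_wirtinger_derivs_mult[OF W[OF sm(4) that] W[OF sm(1) that]]]
    by (simp add: defs algebra_simps)
  have DLp1: "del (?L p1) x = del (\<lambda>y. m2 y * p y + 2 * m1 y * p1 y) x"
    by (rule del_cong_on_open(1)[OF assms(1,2) Lp1])
  have Lp2: "?L p2 x = del m2 x * p x + 3 * m2 x * p1 x + 3 * m1 x * p2 x"
    unfolding defs(3) beltrami_op_del[OF assms(1,2) sm(2) \<mu>] DLp1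
      has_wirtinger_derivs_imp(1)[OF has_wirtinger_derivs_add[OF
          has_wirtinger_derivs_mult[OF W[OF sm(5) assms(2)] W[OF sm(1) assms(2)]]
          has_wirtinger_derivs_mult[OF has_wirtinger_derivs_mult[OF has_wirtinger_derivs_const
              W[OF sm(4) assms(2)]] W[OF sm(2) assms(2)]]]]
    by (simp add: defs algebra_simps)
  show "?L (del F) x = del \<mu> x * del F x" using Lp[OF assms(2)] by (simp add: defs)
  have d: "p differentiable at x" "p1 differentiable at x" "p2 differentiable at x"
    using sm smooth_on_differentiable[OF _ assms(2)] by blast+
  have px: "p x \<noteq> 0" using nz assms(2) by (simp add: defs)
  have S: "schwarzian F = (\<lambda>y. p2 y / p y - (3 / 2) * ((p1 y / p y) * (p1 y / p y)))"
    by (simp add: schwarzian_def[abs_def] defs power2_eq_square)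
  have L32: "?L (\<lambda>y. 3 / 2) x = 0"
    using has_wirtinger_derivs_imp[OF has_wirtinger_derivs_const[of "3/2" x]]
    by (simp add: beltrami_op_def)
  have dq: "(\<lambda>y. p2 y / p y) differentiable at x" "(\<lambda>y. p1 y / p y) differentiable at x"
    using d px by (auto intro!: differentiable_divide)
  have "?L (schwarzian F) x = ?L (\<lambda>y. p2 y / p y) x
      - (3 / 2) * (2 * (p1 x / p x) * ?L (\<lambda>y. p1 y / p y) x)"
    unfolding S
    by (subst beltrami_op_diff beltrami_op_mult; (intro dq differentiable_mult differentiable_const)?)+
      (simp add: L32)
  also have "\<dots> = del m2 x + 2 * m1 x * schwarzian F x"
    unfolding S beltrami_op_divide[OF d(3,1) px] beltrami_op_divide[OF d(2,1) px]
      Lp[OF assms(2)] Lp1[OF assms(2)] Lp2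
    using px by (simp add: field_simps power2_eq_square)
  finally show "?L (schwarzian F) x = del (del (del \<mu>)) x + 2 * del \<mu> x * schwarzian F x"
    by (simp add: defs)
qed

text \<open>
  The local heart of the theorem.  Applying the Beltrami operator to \<open>(H \<circ> F) (\<partial>F)\<^sup>2 = h - {F}\<close>,
  the term \<open>2 \<partial>\<mu> {F}\<close> from the Schwarzian is cancelled by the one from differentiating
  \<open>(\<partial>F)\<^sup>2\<close>, which contributes \<open>2 \<partial>\<mu> (h - {F})\<close>.
\<close>
lemma delbar_push_forward:
  assumes "open S" "x \<in> S"
    and F: "smooth_on F S" and h: "h differentiable at x"
    and jac: "\<And>y. y \<in> S \<Longrightarrow> jacobian_det F y > 0"
    and H: "H differentiable at (F x)"
    and HF: "\<And>y. y \<in> S \<Longrightarrow> H (F y) * (del F y)\<^sup>2 = h y - schwarzian F y"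
  shows "delbar H (F x) * (del F x * of_real (jacobian_det F x))
    = delbar h x - D_op h (\<lambda>y. delbar F y / del F y) x"
proof -
  define \<mu> where "\<mu> = (\<lambda>y. delbar F y / del F y)"
  let ?L = "beltrami_op \<mu>" and ?p = "del F x" and ?q = "delbar F x"
  have nz: "del F y \<noteq> 0" if "y \<in> S" for y
    using jac[OF that] jacobian_det_pos_imp_del_nonzero by blast
  have \<mu>: "smooth_on \<mu> S"
    unfolding \<mu>_def by (intro smooth_on_divide smooth_on_del assms nz)
  have eq: "?L F y = 0" if "y \<in> S" for y
    using nz[OF that] by (simp add: beltrami_op_def \<mu>_def)
  note LS = beltrami_op_schwarzian[OF assms(1,2) F \<mu> nz eq]
  have dF: "F differentiable at x" using smooth_on_differentiable[OF F assms(2)] .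
  have dp: "del F differentiable at x"
    using smooth_on_differentiable[OF smooth_on_del(1)[OF assms(1) F] assms(2)] .
  have dS: "schwarzian F differentiable at x"
    using smooth_on_differentiable[OF smooth_on_schwarzian[OF assms(1) F nz] assms(2)] .
  have "?L h x - ?L (schwarzian F) x = ?L (\<lambda>y. h y - schwarzian F y) x"
    using beltrami_op_diff[OF h dS] by simp
  also have "\<dots> = ?L (\<lambda>y. (H \<circ> F) y * (del F y * del F y)) x"
    by (rule beltrami_op_cong_on_open[OF assms(1,2)]) (simp add: HF flip: power2_eq_square)
  also have "\<dots> = ?L (H \<circ> F) x * ?p\<^sup>2 + H (F x) * (2 * ?p * ?L (del F) x)"
    using differentiable_chain_at[OF dF H] dp
    by (subst beltrami_op_mult; (intro differentiable_mult)?)+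
      (simp_all add: beltrami_op_mult power2_eq_square)
  also have "\<dots> = ?L (H \<circ> F) x * ?p\<^sup>2 + 2 * (h x - schwarzian F x) * del \<mu> x"
    by (simp add: LS(1) power2_eq_square flip: HF[OF assms(2)])
  finally have "?L (H \<circ> F) x * ?p\<^sup>2 = ?L h x - (del (del (del \<mu>)) x + 2 * h x * del \<mu> x)"
    by (simp add: LS(2) algebra_simps)
  then have pull_h: "?L (H \<circ> F) x * ?p\<^sup>2 = delbar h x - D_op h \<mu> x"
    by (simp add: D_op_def beltrami_op_def[of \<mu> h] algebra_simps)
  have pull_H: "?L (H \<circ> F) x = delbar H (F x) * (cnj ?p - \<mu> x * cnj ?q)"
    unfolding beltrami_op_compose[OF dF H] eq[OF assms(2)] by simp
  have jacobian: "(cnj ?p - \<mu> x * cnj ?q) * ?p\<^sup>2 = ?p * of_real (jacobian_det F x)"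
    using nz[OF assms(2)] by (simp add: jacobian_det_eq \<mu>_def field_simps power2_eq_square)
  show ?thesis
    using pull_h unfolding pull_H mult.assoc jacobian unfolding \<mu>_def .
qed

section \<open>Charts of a Riemann surface\<close>

lemma holomorphic_atlas_chart:
  assumes "holomorphic_atlas X I U z" "i \<in> I"
  shows "inj_on (z i) (U i)" "open (z i ` U i)" "U i \<subseteq> topspace X"
proof -
  have U: "openin X (U i)"
    and z: "homeomorphic_map (subtopology X (U i)) (top_of_set (z i ` U i)) (z i)"
    and "open (z i ` U i)"
    using assms by (auto simp: holomorphic_atlas_def)
  then show "open (z i ` U i)" "U i \<subseteq> topspace X" by (auto dest: openin_subset)
  with z show "inj_on (z i) (U i)"
    by (auto simp: homeomorphic_eq_everything_map Int_absorb1)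
qed

text \<open>
  A coordinate change is injective and holomorphic, so its derivative has no zeros; the Schwarzian
  of a coordinate change divides by that derivative.
\<close>
lemma holomorphic_atlas_overlap:
  assumes "holomorphic_atlas X I U z" "i \<in> I" "j \<in> I"
  shows "open (z j ` (U i \<inter> U j))"
    and "transition U z i j holomorphic_on z j ` (U i \<inter> U j)"
    and "\<And>x. x \<in> U j \<Longrightarrow> transition U z i j (z j x) = z i x"
    and "\<And>\<zeta>. \<zeta> \<in> z j ` (U i \<inter> U j) \<Longrightarrow> deriv (transition U z i j) \<zeta> \<noteq> 0"
proof -
  have op: "openin X (U i)" "openin X (U j)"
    and z: "homeomorphic_map (subtopology X (U j)) (top_of_set (z j ` U j)) (z j)"
    and hol: "transition U z i j holomorphic_on z j ` (U i \<inter> U j)"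
    using assms by (auto simp: holomorphic_atlas_def)
  note inj = holomorphic_atlas_chart(1)[OF assms(1)]
  have "openin (subtopology X (U j)) (U i \<inter> U j)"
    using op by (auto simp: openin_subtopology)
  then have "openin (top_of_set (z j ` U j)) (z j ` (U i \<inter> U j))"
    using z homeomorphic_imp_open_map open_map_def by blast
  then show op': "open (z j ` (U i \<inter> U j))"
    using holomorphic_atlas_chart(2)[OF assms(1,3)] openin_open_eq by blast
  show tr: "transition U z i j (z j x) = z i x" if "x \<in> U j" for x
    using that inj[OF assms(3)] by (simp add: transition_def)
  show "transition U z i j holomorphic_on z j ` (U i \<inter> U j)" by (rule hol)
  have "inj_on (transition U z i j) (z j ` (U i \<inter> U j))"
    using inj[OF assms(2)] by (auto simp: inj_on_def tr)
  then show "deriv (transition U z i j) \<zeta> \<noteq> 0" if "\<zeta> \<in> z j ` (U i \<inter> U j)" for \<zeta>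
    using holomorphic_injective_imp_regular[OF hol op'] that by blast
qed

section \<open>The push-forward in charts\<close>

text \<open>
  The representative \<open>F\<close> maps one chart image bijectively onto the other, and its inverse \<open>G\<close>
  represents the inverse diffeomorphism, which is where the smoothness of \<open>G\<close> comes from.
\<close>
lemma deformation_map_chart:
  assumes X: "riemann_surface X I U z" and i: "i \<in> I"
    and f: "deformation_map X I U z Y I (\<lambda>i. f ` U i) w f"
  defines "F \<equiv> local_rep U z w i i f"
    and "G \<equiv> local_rep (\<lambda>i. f ` U i) w z i i (inv_into (topspace X) f)"
  shows "\<And>x. x \<in> U i \<Longrightarrow> F (z i x) = w i (f x)"
    and "F ` z i ` U i = w i ` f ` U i"
    and "smooth_on F (z i ` U i)"
    and "\<And>\<zeta>. \<zeta> \<in> z i ` U i \<Longrightarrow> jacobian_det F \<zeta> > 0"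
    and "smooth_on G (w i ` f ` U i)"
    and "\<And>\<zeta>. \<zeta> \<in> z i ` U i \<Longrightarrow> G (F \<zeta>) = \<zeta>"
    and "\<And>\<zeta>. \<zeta> \<in> z i ` U i \<Longrightarrow> inv_into (z i ` U i) F (F \<zeta>) = \<zeta>"
proof -
  have atX: "holomorphic_atlas X I U z" and atY: "holomorphic_atlas Y I (\<lambda>i. f ` U i) w"
    using X f by (auto simp: riemann_surface_def deformation_map_def)
  have injz: "inj_on (z i) (U i)" and U: "U i \<subseteq> topspace X"
    using holomorphic_atlas_chart[OF atX i] by auto
  have injw: "inj_on (w i) (f ` U i)"
    using holomorphic_atlas_chart(1)[OF atY i] .
  have injf: "inj_on f (topspace X)"
    using f by (auto simp: deformation_map_def diffeomorphism_def homeomorphic_eq_everything_map)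
  show Fz: "F (z i x) = w i (f x)" if "x \<in> U i" for x
    using that injz by (simp add: F_def local_rep_def)
  then show "F ` z i ` U i = w i ` f ` U i" by force
  have Gw: "G (w i (f x)) = z i x" if "x \<in> U i" for x
    using that injw injf U by (auto simp: G_def local_rep_def)
  show GF: "G (F \<zeta>) = \<zeta>" if "\<zeta> \<in> z i ` U i" for \<zeta>
    using that Fz Gw by auto
  then have "inj_on F (z i ` U i)" by (metis inj_onI)
  then show "inv_into (z i ` U i) F (F \<zeta>) = \<zeta>" if "\<zeta> \<in> z i ` U i" for \<zeta>
    using that by simp
  have dom: "U i \<inter> f -` f ` U i = U i" by auto
  have dom': "f ` U i \<inter> inv_into (topspace X) f -` U i = f ` U i"
    using injf U by auto
  show "smooth_on F (z i ` U i)"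
    using f i dom unfolding deformation_map_def diffeomorphism_def smooth_map_def F_def by metis
  show "jacobian_det F \<zeta> > 0" if "\<zeta> \<in> z i ` U i" for \<zeta>
    using f i dom that unfolding deformation_map_def orientation_preserving_def F_def by metis
  show "smooth_on G (w i ` f ` U i)"
    using f i dom' unfolding deformation_map_def diffeomorphism_def smooth_map_def G_def by metis
qed

text \<open>
  On the target chart the push-forward is a quotient of smooth functions composed with \<open>G\<close>.
  Real differentiability is what the Cauchy-Riemann equation has to be paired with to give
  holomorphy.
\<close>
lemma push_forward_chart:
  assumes X: "riemann_surface X I U z" and i: "i \<in> I"
    and f: "deformation_map X I U z Y I (\<lambda>i. f ` U i) w f"
    and h: "smooth_on (h i) (z i ` U i)"
  defines "F \<equiv> local_rep U z w i i f" and "H \<equiv> push_forward U z w f h i"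
  shows "\<And>\<zeta>. \<zeta> \<in> z i ` U i \<Longrightarrow> H (F \<zeta>) * (del F \<zeta>)\<^sup>2 = h i \<zeta> - schwarzian F \<zeta>"
    and "\<And>\<eta>. \<eta> \<in> w i ` f ` U i \<Longrightarrow> H differentiable at \<eta>"
proof -
  define G where "G = local_rep (\<lambda>i. f ` U i) w z i i (inv_into (topspace X) f)"
  note chart = deformation_map_chart[OF X i f, folded F_def G_def]
  have op: "open (z i ` U i)" "open (w i ` f ` U i)"
    using X f holomorphic_atlas_chart(2)[OF _ i]
    by (fastforce simp: riemann_surface_def deformation_map_def)+
  have nz: "del F \<zeta> \<noteq> 0" if "\<zeta> \<in> z i ` U i" for \<zeta>
    using chart(4)[OF that] jacobian_det_pos_imp_del_nonzero by blast
  define K where "K = (\<lambda>\<zeta>. (h i \<zeta> - schwarzian F \<zeta>) / (del F \<zeta>)\<^sup>2)"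
  have HF: "H (F \<zeta>) = K \<zeta>" if "\<zeta> \<in> z i ` U i" for \<zeta>
    by (simp add: H_def push_forward_def Let_def chart(7)[OF that] K_def flip: F_def)
  then show "H (F \<zeta>) * (del F \<zeta>)\<^sup>2 = h i \<zeta> - schwarzian F \<zeta>" if "\<zeta> \<in> z i ` U i" for \<zeta>
    using that nz by (simp add: K_def)
  have K: "K differentiable at \<zeta>" if "\<zeta> \<in> z i ` U i" for \<zeta>
    unfolding K_def
    by (intro differentiable_divide differentiable_diff differentiable_power
        smooth_on_differentiable[OF h that]
        smooth_on_differentiable[OF smooth_on_schwarzian[OF op(1) chart(3) nz] that]
        smooth_on_differentiable[OF smooth_on_del(1)[OF op(1) chart(3)] that])
      (use nz[OF that] in auto)
  show "H differentiable at \<eta>" if "\<eta> \<in> w i ` f ` U i" for \<eta>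
  proof -
    have "G \<eta> \<in> z i ` U i" using that chart(2,6) by (metis imageE)
    then have "(K \<circ> G) differentiable at \<eta>"
      using differentiable_chain_at[OF smooth_on_differentiable[OF chart(5) that] K] by blast
    moreover have "(K \<circ> G) y = H y" if "y \<in> w i ` f ` U i" for y
      using that chart(2,6) HF by (metis comp_apply imageE)
    ultimately show ?thesis
      using has_derivative_transform_within_open[of "K \<circ> G" _ \<eta> UNIV "w i ` f ` U i" H] op(2) that
      unfolding differentiable_def by blast
  qed
qed

text \<open>
  Pull the claim back by \<open>F\<^sub>j\<close> and multiply by \<open>(\<partial>F\<^sub>j)\<^sup>2\<close>.  The transformation law of \<open>h\<close> and
  the chain rule for \<open>F\<^sub>i \<circ> s\<close> collapse the left-hand side to \<open>{F\<^sub>i \<circ> s} - {F\<^sub>j}\<close>, where \<open>s\<close> is the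
  coordinate change on the source.  Since \<open>F\<^sub>i \<circ> s = t \<circ> F\<^sub>j\<close>, the chain rule with the holomorphic
  function \<open>t\<close> outside turns this into \<open>({t} \<circ> F\<^sub>j) (\<partial>F\<^sub>j)\<^sup>2\<close>.
\<close>
lemma push_forward_transformation_law:
  assumes X: "riemann_surface X I U z" and ij: "i \<in> I" "j \<in> I"
    and f: "deformation_map X I U z Y I (\<lambda>i. f ` U i) w f"
    and h: "smooth_projective_connection I U z h"
    and \<eta>: "\<eta> \<in> w j ` (f ` U i \<inter> f ` U j)"
  defines "t \<equiv> transition (\<lambda>i. f ` U i) w i j" and "H \<equiv> push_forward U z w f h"
  shows "H j \<eta> - H i (t \<eta>) * (deriv t \<eta>)\<^sup>2 = schwarzian t \<eta>"
proof -
  let ?F = "\<lambda>i. local_rep U z w i i f"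
  define s where "s = transition U z i j"
  have atX: "holomorphic_atlas X I U z" and atY: "holomorphic_atlas Y I (\<lambda>i. f ` U i) w"
    using X f by (auto simp: riemann_surface_def deformation_map_def)
  have hs: "smooth_on (h k) (z k ` U k)" if "k \<in> I" for k
    using h that by (simp add: smooth_projective_connection_def)
  have injf: "inj_on f (topspace X)"
    using f by (auto simp: deformation_map_def diffeomorphism_def homeomorphic_eq_everything_map)
  have U: "U i \<subseteq> topspace X" "U j \<subseteq> topspace X"
    using holomorphic_atlas_chart(3)[OF atX] ij by auto
  note chart = deformation_map_chart[OF X _ f]
  note push = push_forward_chart(1)[where h = h, OF X _ f hs, folded H_def]
  note sx = holomorphic_atlas_overlap[OF atX ij, folded s_def]
  note ty = holomorphic_atlas_overlap[OF atY ij, folded t_def]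
  have ff: "f ` U i \<inter> f ` U j = f ` (U i \<inter> U j)"
    using inj_on_image_Int[OF injf U] by simp
  define R where "R = z j ` (U i \<inter> U j)"
  define T where "T = w j ` f ` (U i \<inter> U j)"
  note sx = sx[folded R_def] and ty = ty[unfolded ff, folded T_def]
  have Rj: "R \<subseteq> z j ` U j" by (auto simp: R_def)
  have sR: "s ` R \<subseteq> z i ` U i" by (auto simp: R_def sx(3))
  have FR: "?F j ` R \<subseteq> T" by (auto simp: R_def T_def chart(1)[OF ij(2)])
  obtain x where x: "x \<in> U i" "x \<in> U j" "\<eta> = w j (f x)" using \<eta> ff by auto
  define \<zeta> where "\<zeta> = z j x"
  have \<zeta>: "\<zeta> \<in> R" "\<eta> = ?F j \<zeta>" using x by (auto simp: \<zeta>_def R_def chart(1)[OF ij(2)])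
  have comm: "(?F i \<circ> s) y = (t \<circ> ?F j) y" if "y \<in> R" for y
    using that by (auto simp: R_def sx(3) ty(3) chart(1)[OF ij(1)] chart(1)[OF ij(2)])
  have opS: "open (z i ` U i)" using holomorphic_atlas_chart(2)[OF atX ij(1)] .
  have nzF: "del (?F k) y \<noteq> 0" if "k \<in> I" "y \<in> z k ` U k" for k y
    using chart(4)[OF that] jacobian_det_pos_imp_del_nonzero by blast
  have s: "del s y = deriv s y" "delbar s y = 0" "deriv s y \<noteq> 0" if "y \<in> R" for y
    using holomorphic_on_imp_del_eq_deriv[OF sx(2,1) that] sx(4)[OF that] by auto
  have t: "del t y = deriv t y" "delbar t y = 0" "deriv t y \<noteq> 0" if "y \<in> T" for y
    using holomorphic_on_imp_del_eq_deriv[OF ty(2,1) that] ty(4)[OF that] by auto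
  have smj: "smooth_on (?F j) R"
    by (rule smooth_on_subset[OF chart(3)[OF ij(2)] Rj])
  have sm: "smooth_on s R" "smooth_on t T"
    using holomorphic_on_imp_smooth_on sx(1,2) ty(1,2) by blast+
  have \<eta>T: "\<eta> \<in> T" using \<zeta> FR by auto
  have s\<zeta>: "s \<zeta> \<in> z i ` U i" using \<zeta> sR by auto
  have A: "schwarzian (?F i \<circ> s) \<zeta> = schwarzian (?F i) (s \<zeta>) * (deriv s \<zeta>)\<^sup>2 + schwarzian s \<zeta>"
    using schwarzian_compose[OF sx(1) opS sR sm(1) chart(3)[OF ij(1)] disjI1[OF sx(2)] _ nzF[OF ij(1)] \<zeta>(1)]
      s \<zeta>(1) by simp
  have B: "schwarzian (t \<circ> ?F j) \<zeta>
      = schwarzian t \<eta> * (del (?F j) \<zeta>)\<^sup>2 + schwarzian (?F j) \<zeta>"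
    using schwarzian_compose[OF sx(1) ty(1) FR smj sm(2) disjI2[OF ty(2)] _ _ \<zeta>(1)]
      nzF[OF ij(2)] Rj t \<zeta> by (simp add: subset_eq)
  have C: "del (?F i) (s \<zeta>) * deriv s \<zeta> = deriv t \<eta> * del (?F j) \<zeta>"
  proof -
    have "del (?F i \<circ> s) \<zeta> = del (?F i) (s \<zeta>) * deriv s \<zeta>"
      using del_compose[OF smooth_on_differentiable[OF sm(1) \<zeta>(1)]
          smooth_on_differentiable[OF chart(3)[OF ij(1)] s\<zeta>]] s[OF \<zeta>(1)] by simp
    moreover have "del (t \<circ> ?F j) \<zeta> = deriv t \<eta> * del (?F j) \<zeta>"
      using del_compose[OF smooth_on_differentiable[OF smj \<zeta>(1)]
          smooth_on_differentiable[OF sm(2) \<eta>T, unfolded \<zeta>(2)]] t[OF \<eta>T] \<zeta>(2) by simp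
    moreover have "del (?F i \<circ> s) \<zeta> = del (t \<circ> ?F j) \<zeta>"
      by (rule del_cong_on_open(1)[OF sx(1) \<zeta>(1) comm])
    ultimately show ?thesis by simp
  qed
  have t\<eta>: "t \<eta> = ?F i (s \<zeta>)" using comm[OF \<zeta>(1)] \<zeta>(2) by simp
  have hij: "h j \<zeta> - h i (s \<zeta>) * (deriv s \<zeta>)\<^sup>2 = schwarzian s \<zeta>"
    using h ij \<zeta>(1) by (auto simp: smooth_projective_connection_def s_def R_def)
  have "(H j \<eta> - H i (t \<eta>) * (deriv t \<eta>)\<^sup>2) * (del (?F j) \<zeta>)\<^sup>2
      = H j (?F j \<zeta>) * (del (?F j) \<zeta>)\<^sup>2
        - H i (?F i (s \<zeta>)) * (del (?F i) (s \<zeta>))\<^sup>2 * (deriv s \<zeta>)\<^sup>2"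
    using C unfolding t\<eta> \<zeta>(2)[symmetric]
    by (simp add: algebra_simps flip: power_mult_distrib)
  also have "\<dots> = h j \<zeta> - schwarzian (?F j) \<zeta>
        - (h i (s \<zeta>) - schwarzian (?F i) (s \<zeta>)) * (deriv s \<zeta>)\<^sup>2"
    using push[OF ij(2) ij(2)] push[OF ij(1) ij(1) s\<zeta>] \<zeta>(1) Rj by auto
  also have "\<dots> = schwarzian (?F i \<circ> s) \<zeta> - schwarzian (?F j) \<zeta>"
    unfolding A hij[symmetric] by (simp add: algebra_simps)
  also have "\<dots> = schwarzian t \<eta> * (del (?F j) \<zeta>)\<^sup>2"
  proof -
    have "schwarzian (?F i \<circ> s) \<zeta> = schwarzian (t \<circ> ?F j) \<zeta>"
      by (rule schwarzian_cong_on_open[OF sx(1) \<zeta>(1) comm])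
    with B show ?thesis by simp
  qed
  finally show ?thesis using nzF[OF ij(2)] \<zeta>(1) Rj by auto
qed

text \<open>
  Chart by chart, the factor \<open>J \<partial>F\<close> does not vanish, so the Euler-Lagrange equation is the
  Cauchy-Riemann equation for the push-forward.  The transformation law holds in either case, and
  smoothness comes with holomorphy.
\<close>
theorem theorem4p2p1:
  fixes X :: "'a topology" and Y :: "'b topology"
    and I :: "'i set" and U :: "'i \<Rightarrow> 'a set" and z :: "'i \<Rightarrow> 'a \<Rightarrow> complex"
    and w :: "'i \<Rightarrow> 'b \<Rightarrow> complex"
    and f :: "'a \<Rightarrow> 'b" and h :: "'i \<Rightarrow> complex \<Rightarrow> complex" and g :: nat
  assumes "riemann_surface X I U z"
    and "good_cover X I U"
    and "compact_space X"
    and "has_genus X g" and "g > 1"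
    and "smooth_projective_connection I U z h"
    and "deformation_map X I U z Y I (\<lambda>i. f ` U i) w f"
  shows "euler_lagrange I U z h (beltrami U z w f) \<longleftrightarrow>
         holomorphic_projective_connection I (\<lambda>i. f ` U i) w (push_forward U z w f h)"
proof -
  let ?F = "\<lambda>i. local_rep U z w i i f" and ?H = "push_forward U z w f h"
  note X = assms(1) and h = assms(6) and f = assms(7)
  have hs: "smooth_on (h i) (z i ` U i)" if "i \<in> I" for i
    using h that by (simp add: smooth_projective_connection_def)
  have op: "open (z i ` U i)" "open (w i ` f ` U i)" if "i \<in> I" for i
    using X f holomorphic_atlas_chart(2)[OF _ that]
    by (fastforce simp: riemann_surface_def deformation_map_def)+
  have local: "(\<forall>\<zeta> \<in> z i ` U i. delbar (h i) \<zeta> = D_op (h i) (beltrami U z w f i) \<zeta>)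
      \<longleftrightarrow> ?H i holomorphic_on w i ` f ` U i" (is "?EL \<longleftrightarrow> ?hol") if i: "i \<in> I" for i
  proof -
    note chart = deformation_map_chart[OF X i f] and push = push_forward_chart[where h = h, OF X i f hs[OF i]]
    have "delbar (?H i) (?F i \<zeta>) = 0 \<longleftrightarrow> delbar (h i) \<zeta> = D_op (h i) (beltrami U z w f i) \<zeta>"
      if \<zeta>: "\<zeta> \<in> z i ` U i" for \<zeta>
    proof -
      have "?F i \<zeta> \<in> w i ` f ` U i" using chart(2) \<zeta> by blast
      from delbar_push_forward[OF op(1)[OF i] \<zeta> chart(3) smooth_on_differentiable[OF hs[OF i] \<zeta>]
          chart(4) push(2)[OF this] push(1)]
      have "delbar (?H i) (?F i \<zeta>) * (del (?F i) \<zeta> * of_real (jacobian_det (?F i) \<zeta>))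
          = delbar (h i) \<zeta> - D_op (h i) (beltrami U z w f i) \<zeta>"
        by (simp add: beltrami_def[abs_def])
      moreover have "del (?F i) \<zeta> \<noteq> 0" "jacobian_det (?F i) \<zeta> \<noteq> 0"
        using chart(4)[OF \<zeta>] jacobian_det_pos_imp_del_nonzero by auto
      ultimately show ?thesis by (metis eq_iff_diff_eq_0 mult_eq_0_iff of_real_eq_0_iff)
    qed
    then have "?EL \<longleftrightarrow> (\<forall>\<eta> \<in> ?F i ` z i ` U i. delbar (?H i) \<eta> = 0)"
      by simp
    also have "\<dots> \<longleftrightarrow> (\<forall>\<eta> \<in> w i ` f ` U i. delbar (?H i) \<eta> = 0)"
      by (simp only: chart(2))
    also have "\<dots> \<longleftrightarrow> ?hol"
      using cauchy_riemann_imp_holomorphic_on[OF op(2)[OF i] push(2)]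
        holomorphic_on_imp_del_eq_deriv(2)[OF _ op(2)[OF i]] by blast
    finally show ?thesis .
  qed
  have "holomorphic_projective_connection I (\<lambda>i. f ` U i) w ?H
      \<longleftrightarrow> (\<forall>i\<in>I. ?H i holomorphic_on w i ` f ` U i)"
    using push_forward_transformation_law[OF X _ _ f h] holomorphic_on_imp_smooth_on[OF op(2)]
    unfolding holomorphic_projective_connection_def smooth_projective_connection_def by blast
  then show ?thesis
    using local by (simp add: euler_lagrange_def)
qed

end
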